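(* Let $F:\mathbb{R}^{m+1}\to\mathbb{R}^{n+1}$ be a quadratic form given by $$F(\overline{x})=\left(X^tA_1X,\ldots,X^tA_{n+1}X\right),$$ where $X$ is the column vector of $\overline{x}\in\mathbb{R}^{m+1}$ and $A_1,\ldots,A_{n+1}$ are real symmetric matrices of order $m+1$, such that $|\overline{x}|=1$ implies $|F(\overline{x})|=1$. Let $\phi:\mathbb{S}^m\to\mathbb{S}^n$ be defined by $\phi(\overline{x})=F(\overline{x})$, assumed non-constant, and let $\varphi=i\circ\phi:\mathbb{S}^m\to\mathbb{R}^{n+1}$, where $i:\mathbb{S}^n\to\mathbb{R}^{n+1}$ is the inclusion. Put $S=A_1^2+A_2^2+\cdots+A_{n+1}^2$. Then, at a point $\overline{x}\in\mathbb{S}^m$, the bitension field of $\phi$ is \begin{align*} \tau_2(\phi)=\;&-4\left(m+5-4X^tSX\right)\left(\operatorname{tr}A_1,\operatorname{tr}A_2,\ldots,\operatorname{tr}A_{n+1}\right)\\ &+\Big(8\operatorname{tr}S+4\left((\operatorname{tr}A_1)^2+\cdots+(\operatorname{tr}A_{n+1})^2\right)\\ &\quad-8(3m+15)X^tSX+32\left(X^tSX\right)^2+16(m+3)\Big)\varphi\\ &+32\left(X^tA_1SX,\ldots,X^tA_{n+1}SX\right). \end{align*}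
   Context: $\mathbb{S}^m$ is the unit sphere in $\mathbb{R}^{m+1}$ with its round metric. Tangent vectors to $\mathbb{S}^n$ are identified with vectors of $\mathbb{R}^{n+1}$, so $\tau_2(\phi)$ is viewed as an $\mathbb{R}^{n+1}$-valued function on $\mathbb{S}^m$. For a smooth map $\phi:(M,g)\to(N,h)$ between Riemannian manifolds, the tension field is $\tau(\phi)=\operatorname{trace}\nabla d\phi$ and the bitension field is $\tau_2(\phi)=-\Delta\tau(\phi)-\operatorname{trace}R^N(d\phi(\cdot),\tau(\phi))d\phi(\cdot)$, where $\Delta\sigma=-\operatorname{trace}_g\nabla^2\sigma$ is the rough Laplacian on sections of $\phi^{-1}TN$ and $R(X,Y)Z=\nabla_X\nabla_YZ-\nabla_Y\nabla_XZ-\nabla_{[X,Y]}Z$. *)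

theory Defs
  imports "HOL-Analysis.Analysis"
begin

text \<open>
  Riemannian geometry of smooth submanifolds \<open>M\<close>, \<open>N\<close> of Euclidean spaces with the induced metric.
  Tangent vectors are vectors of the ambient space. A map out of \<open>M\<close> is a total function on the
  ambient space, but every notion below depends only on its values on \<open>M\<close>.
\<close>

definition tangent_space :: "'a::euclidean_space set \<Rightarrow> 'a \<Rightarrow> 'a set" where
  "tangent_space M x =
    {v. \<exists>\<gamma>. (\<forall>t. \<gamma> t \<in> M) \<and> \<gamma> 0 = x \<and> (\<gamma> has_vector_derivative v) (at (0::real))}"

text \<open>The orthogonal projection onto the linear subspace \<open>tangent_space M x\<close>.\<close>

definition tangent_proj :: "'a::euclidean_space set \<Rightarrow> 'a \<Rightarrow> 'a \<Rightarrow> 'a" where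
  "tangent_proj M x = closest_point (tangent_space M x)"

text \<open>
  The derivative within \<open>M\<close> is determined by \<open>f\<close> only on \<open>tangent_space M x\<close>; it is never applied
  to vectors that are not tangent to \<open>M\<close>.
\<close>

definition differential ::
    "'a::euclidean_space set \<Rightarrow> ('a \<Rightarrow> 'b::euclidean_space) \<Rightarrow> 'a \<Rightarrow> 'a \<Rightarrow> 'b" where
  "differential M f x = frechet_derivative f (at x within M)"

text \<open>
  The connection on \<open>\<phi>\<^sup>-\<^sup>1TN\<close> induced by the Levi-Civita connection of \<open>N\<close>, applied to a
  section \<open>\<sigma>\<close> (so \<open>\<sigma> y\<close> is tangent to \<open>N\<close> at \<open>\<phi> y\<close>) and a tangent vector \<open>u\<close> at \<open>x\<close>. As \<open>N\<close>
  carries the metric induced from the ambient Euclidean space, its Levi-Civita connection is the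
  tangential part of the ambient derivative.
\<close>

definition pullback_conn ::
    "'a::euclidean_space set \<Rightarrow> 'b::euclidean_space set \<Rightarrow> ('a \<Rightarrow> 'b) \<Rightarrow> ('a \<Rightarrow> 'b) \<Rightarrow> 'a \<Rightarrow> 'a \<Rightarrow> 'b"
  where "pullback_conn M N \<phi> \<sigma> x u = tangent_proj N (\<phi> x) (differential M \<sigma> x u)"

definition levi_civita :: "'a::euclidean_space set \<Rightarrow> ('a \<Rightarrow> 'a) \<Rightarrow> 'a \<Rightarrow> 'a \<Rightarrow> 'a" where
  "levi_civita M V x u = tangent_proj M x (differential M V x u)"

definition lie_bracket :: "'a::euclidean_space set \<Rightarrow> ('a \<Rightarrow> 'a) \<Rightarrow> ('a \<Rightarrow> 'a) \<Rightarrow> 'a \<Rightarrow> 'a" where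
  "lie_bracket M V W x = differential M W x (V x) - differential M V x (W x)"

text \<open>
  A vector field on \<open>M\<close> with value \<open>v\<close> at a point where \<open>v\<close> is tangent to \<open>M\<close>. The tensors below are
  evaluated on tangent vectors through such fields; being tensorial, they do not depend on the
  choice of the extending fields.
\<close>

definition field_ext :: "'a::euclidean_space set \<Rightarrow> 'a \<Rightarrow> 'a \<Rightarrow> 'a" where
  "field_ext M v = (\<lambda>y. tangent_proj M y v)"

definition curvature_fields ::
    "'a::euclidean_space set \<Rightarrow> ('a \<Rightarrow> 'a) \<Rightarrow> ('a \<Rightarrow> 'a) \<Rightarrow> ('a \<Rightarrow> 'a) \<Rightarrow> 'a \<Rightarrow> 'a" where
  "curvature_fields M V W Z x =
     levi_civita M (\<lambda>y. levi_civita M Z y (W y)) x (V x)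
   - levi_civita M (\<lambda>y. levi_civita M Z y (V y)) x (W x)
   - levi_civita M Z x (lie_bracket M V W x)"

definition curvature :: "'a::euclidean_space set \<Rightarrow> 'a \<Rightarrow> 'a \<Rightarrow> 'a \<Rightarrow> 'a \<Rightarrow> 'a" where
  "curvature M x u v w = curvature_fields M (field_ext M u) (field_ext M v) (field_ext M w) x"

definition orthonormal_basis :: "'a::euclidean_space set \<Rightarrow> 'a set \<Rightarrow> bool" where
  "orthonormal_basis V E \<longleftrightarrow> pairwise orthogonal E \<and> (\<forall>e\<in>E. norm e = 1) \<and> span E = V"

text \<open>The trace of a bilinear map on \<open>tangent_space M x\<close>, which is independent of the basis.\<close>

definition metric_trace ::
    "'a::euclidean_space set \<Rightarrow> 'a \<Rightarrow> ('a \<Rightarrow> 'a \<Rightarrow> 'b::euclidean_space) \<Rightarrow> 'b" where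
  "metric_trace M x B = (\<Sum>e\<in>(SOME E. orthonormal_basis (tangent_space M x) E). B e e)"

text \<open>\<open>(\<nabla>d\<phi>)(V, W) = \<nabla>\<^sub>V(d\<phi>(W)) - d\<phi>(\<nabla>\<^sub>V W)\<close>.\<close>

definition second_fundamental_form ::
    "'a::euclidean_space set \<Rightarrow> 'b::euclidean_space set \<Rightarrow> ('a \<Rightarrow> 'b) \<Rightarrow> 'a \<Rightarrow> 'a \<Rightarrow> 'a \<Rightarrow> 'b" where
  "second_fundamental_form M N \<phi> x u v =
     pullback_conn M N \<phi> (\<lambda>y. differential M \<phi> y (field_ext M v y)) x u
   - differential M \<phi> x (levi_civita M (field_ext M v) x u)"

definition tension_field ::
    "'a::euclidean_space set \<Rightarrow> 'b::euclidean_space set \<Rightarrow> ('a \<Rightarrow> 'b) \<Rightarrow> 'a \<Rightarrow> 'b" where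
  "tension_field M N \<phi> x = metric_trace M x (second_fundamental_form M N \<phi> x)"

text \<open>\<open>(\<nabla>\<^sup>2\<sigma>)(V, W) = \<nabla>\<^sub>V(\<nabla>\<^sub>W \<sigma>) - \<nabla>\<^sub>U \<sigma>\<close> where \<open>U = \<nabla>\<^sub>V W\<close>.\<close>

definition second_cov_deriv ::
    "'a::euclidean_space set \<Rightarrow> 'b::euclidean_space set \<Rightarrow> ('a \<Rightarrow> 'b) \<Rightarrow> ('a \<Rightarrow> 'b) \<Rightarrow> 'a \<Rightarrow> 'a \<Rightarrow> 'a \<Rightarrow> 'b"
  where "second_cov_deriv M N \<phi> \<sigma> x u v =
     pullback_conn M N \<phi> (\<lambda>y. pullback_conn M N \<phi> \<sigma> y (field_ext M v y)) x u
   - pullback_conn M N \<phi> \<sigma> x (levi_civita M (field_ext M v) x u)"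

definition rough_laplacian ::
    "'a::euclidean_space set \<Rightarrow> 'b::euclidean_space set \<Rightarrow> ('a \<Rightarrow> 'b) \<Rightarrow> ('a \<Rightarrow> 'b) \<Rightarrow> 'a \<Rightarrow> 'b" where
  "rough_laplacian M N \<phi> \<sigma> x = - metric_trace M x (second_cov_deriv M N \<phi> \<sigma> x)"

definition bitension_field ::
    "'a::euclidean_space set \<Rightarrow> 'b::euclidean_space set \<Rightarrow> ('a \<Rightarrow> 'b) \<Rightarrow> 'a \<Rightarrow> 'b" where
  "bitension_field M N \<phi> x =
   - rough_laplacian M N \<phi> (tension_field M N \<phi>) x
   - metric_trace M x (\<lambda>u v. curvature N (\<phi> x)
       (differential M \<phi> x u) (tension_field M N \<phi> x) (differential M \<phi> x v))"

text \<open>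
  Checks: on the unit sphere these notions are the expected ones, and \<open>levi_civita\<close> is metric and
  torsion-free.
\<close>

lemma tangent_space_sphere:
  fixes x :: "'a::euclidean_space"
  assumes x: "norm x = 1"
  shows "tangent_space (sphere 0 1) x = {v. x \<bullet> v = 0}"
proof (intro set_eqI iffI)
  fix v assume "v \<in> tangent_space (sphere 0 1) x"
  then obtain g where g: "\<And>t. norm (g t) = 1" "g 0 = x" "(g has_vector_derivative v) (at (0::real))"
    unfolding tangent_space_def by auto
  have "((\<lambda>t. g t \<bullet> g t) has_derivative (\<lambda>t. g 0 \<bullet> (t *\<^sub>R v) + (t *\<^sub>R v) \<bullet> g 0)) (at (0::real))"
    using g(3) unfolding has_vector_derivative_def by (intro has_derivative_inner)
  moreover have "(\<lambda>t. g t \<bullet> g t) = (\<lambda>t. 1)"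
    using g(1) by (auto simp: dot_square_norm)
  ultimately have "((\<lambda>t::real. 1::real) has_derivative (\<lambda>t. g 0 \<bullet> (t *\<^sub>R v) + (t *\<^sub>R v) \<bullet> g 0)) (at 0)"
    by simp
  then have "(\<lambda>t. g 0 \<bullet> (t *\<^sub>R v) + (t *\<^sub>R v) \<bullet> g 0) = (\<lambda>t. 0)"
    using has_derivative_unique has_derivative_const by blast
  from fun_cong[OF this, of 1] show "v \<in> {v. x \<bullet> v = 0}"
    using g(2) by (simp add: inner_commute)
next
  fix v assume "v \<in> {v. x \<bullet> v = 0}"
  then have xv: "x \<bullet> v = 0" by simp
  define g where "g = (\<lambda>t. cos (norm v * t) *\<^sub>R x + sin (norm v * t) *\<^sub>R sgn v)"
  have "norm (g t) = 1" for t
  proof (cases "v = 0")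
    case True then show ?thesis using x by (simp add: g_def)
  next
    case False
    have "x \<bullet> sgn v = 0" "norm (sgn v) = 1" using xv False by (simp_all add: sgn_div_norm)
    then have "(norm (g t))\<^sup>2 = (cos (norm v * t))\<^sup>2 + (sin (norm v * t))\<^sup>2"
      using x unfolding power2_norm_eq_inner g_def
      by (simp add: inner_add_left inner_add_right inner_commute power2_eq_square norm_eq_1)
    then have "(norm (g t))\<^sup>2 = 1" by simp
    then show ?thesis unfolding power2_eq_1_iff using norm_ge_zero[of "g t"] by linarith
  qed
  moreover have "g 0 = x" by (simp add: g_def)
  moreover have "(g has_vector_derivative v) (at 0)"
    unfolding g_def
    by (cases "v = 0") (auto intro!: derivative_eq_intros simp: sgn_div_norm)
  ultimately show "v \<in> tangent_space (sphere 0 1) x"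
    unfolding tangent_space_def by auto
qed

lemma tangent_proj_sphere:
  fixes x :: "'a::euclidean_space"
  assumes x: "norm x = 1"
  shows "tangent_proj (sphere 0 1) x v = v - (x \<bullet> v) *\<^sub>R x"
proof -
  let ?T = "{u. x \<bullet> u = 0}" and ?w = "v - (x \<bullet> v) *\<^sub>R x"
  have xx: "x \<bullet> x = 1" using x by (simp add: norm_eq_1)
  have "dist v ?w \<le> dist v u" if "u \<in> ?T" for u
  proof -
    have "\<bar>x \<bullet> (v - u)\<bar> \<le> norm x * norm (v - u)" by (rule Cauchy_Schwarz_ineq2)
    then show ?thesis using that x by (simp add: dist_norm inner_diff_right)
  qed
  moreover have "?w \<in> ?T" using xx by (simp add: inner_diff_right)
  moreover have "convex ?T" "closed ?T"
    by (rule convex_hyperplane, rule closed_hyperplane)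
  ultimately have "?w = closest_point ?T v"
    by (intro closest_point_unique) auto
  then show ?thesis by (simp add: tangent_proj_def tangent_space_sphere[OF x])
qed

lemma differential_works:
  assumes "(f has_derivative f') (at x within M)" and "v \<in> tangent_space M x"
  shows "differential M f x v = f' v"
proof -
  from assms(2) obtain g where g: "\<And>t. g t \<in> M" "g 0 = x"
      "(g has_derivative (\<lambda>t. t *\<^sub>R v)) (at (0::real))"
    unfolding tangent_space_def has_vector_derivative_def by auto
  have chain: "((f \<circ> g) has_derivative (D \<circ> (\<lambda>t. t *\<^sub>R v))) (at 0)"
    if "(f has_derivative D) (at x within M)" for D
    using that g by (intro diff_chain_within) (auto intro: has_derivative_subset)
  have "(f has_derivative differential M f x) (at x within M)"
    unfolding differential_def
    using assms(1) frechet_derivative_works differentiable_def by blast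
  from chain[OF this] chain[OF assms(1)]
  have "differential M f x \<circ> (\<lambda>t. t *\<^sub>R v) = f' \<circ> (\<lambda>t. t *\<^sub>R v)"
    by (rule has_derivative_unique)
  from fun_cong[OF this, of 1] show ?thesis by simp
qed

lemma levi_civita_sphere_metric:
  fixes x :: "'a::euclidean_space"
  assumes x: "norm x = 1" and u: "x \<bullet> u = 0"
    and V: "V differentiable (at x within sphere 0 1)" "\<And>y. norm y = 1 \<Longrightarrow> y \<bullet> V y = 0"
    and W: "W differentiable (at x within sphere 0 1)" "\<And>y. norm y = 1 \<Longrightarrow> y \<bullet> W y = 0"
  shows "differential (sphere 0 1) (\<lambda>y. V y \<bullet> W y) x u =
    levi_civita (sphere 0 1) V x u \<bullet> W x + V x \<bullet> levi_civita (sphere 0 1) W x u"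
proof -
  let ?D = "differential (sphere (0::'a) 1)"
  have "((\<lambda>y. V y \<bullet> W y) has_derivative (\<lambda>h. V x \<bullet> ?D W x h + ?D V x h \<bullet> W x))
      (at x within sphere 0 1)"
    using V(1) W(1) unfolding differential_def frechet_derivative_works
    by (intro has_derivative_inner)
  then have "?D (\<lambda>y. V y \<bullet> W y) x u = V x \<bullet> ?D W x u + ?D V x u \<bullet> W x"
    by (rule differential_works) (simp add: tangent_space_sphere x u)
  then show ?thesis
    using V(2)[OF x] W(2)[OF x]
    by (simp add: levi_civita_def tangent_proj_sphere x inner_diff_left inner_diff_right inner_commute)
qed

lemma levi_civita_sphere_torsion_free:
  fixes x :: "'a::euclidean_space"
  assumes x: "norm x = 1"
    and V: "V differentiable (at x within sphere 0 1)" "\<And>y. norm y = 1 \<Longrightarrow> y \<bullet> V y = 0"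
    and W: "W differentiable (at x within sphere 0 1)" "\<And>y. norm y = 1 \<Longrightarrow> y \<bullet> W y = 0"
  shows "levi_civita (sphere 0 1) W x (V x) - levi_civita (sphere 0 1) V x (W x) =
    lie_bracket (sphere 0 1) V W x"
proof -
  let ?D = "differential (sphere (0::'a) 1)"
  have normal: "x \<bullet> ?D Z x u = - (u \<bullet> Z x)"
    if Z: "Z differentiable (at x within sphere 0 1)" "\<And>y. norm y = 1 \<Longrightarrow> y \<bullet> Z y = 0"
      and u: "x \<bullet> u = 0" for Z u
  proof -
    have "((\<lambda>y. y \<bullet> Z y) has_derivative (\<lambda>h. x \<bullet> ?D Z x h + h \<bullet> Z x)) (at x within sphere 0 1)"
      using Z(1) unfolding differential_def frechet_derivative_works
      by (intro has_derivative_inner has_derivative_ident)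
    then have "?D (\<lambda>y. y \<bullet> Z y) x u = x \<bullet> ?D Z x u + u \<bullet> Z x"
      by (rule differential_works) (simp add: tangent_space_sphere x u)
    moreover have "((\<lambda>y. y \<bullet> Z y) has_derivative (\<lambda>h. 0)) (at x within sphere 0 1)"
      by (rule has_derivative_transform[OF _ _ has_derivative_const[of 0]]) (use x Z(2) in auto)
    then have "?D (\<lambda>y. y \<bullet> Z y) x u = 0"
      by (rule differential_works) (simp add: tangent_space_sphere x u)
    ultimately have "x \<bullet> ?D Z x u + u \<bullet> Z x = 0" by simp
    then show ?thesis by simp
  qed
  show ?thesis
    using normal[OF W V(2)[OF x]] normal[OF V W(2)[OF x]]
    by (simp add: levi_civita_def lie_bracket_def tangent_proj_sphere x inner_commute)
qed

end

theory Submission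
  imports Defs
begin

text \<open>
  Write \<open>P\<^bsub>p\<^esub>\<close> for the orthogonal projection onto the tangent space of the unit sphere at \<open>p\<close>, and
  let \<open>f\<close> be a smooth map of Euclidean spaces that takes the unit sphere to the unit sphere. For a
  smooth \<open>G\<close> on the ambient space, the Hessian of the restriction of \<open>G\<close> to the sphere is
  \<open>G''(u, v) - (u \<bullet> v) G'(x)\<close>, where the last derivative is in the direction \<open>x\<close>, and the trace
  \<open>\<Delta> G\<close> of this Hessian is \<open>sphere_laplacian\<close>. The Levi-Civita connection of the target is the
  tangential part of the ambient derivative, hence \<open>\<tau> = P(\<Delta> f)\<close> (\<open>tension_field_eq\<close>). Let \<open>\<sigma>\<close> be
  an extension of \<open>\<tau>\<close> to the ambient space. Differentiating \<open>\<tau>\<close> twice produces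
  \<open>P(\<Delta> \<sigma>) + \<Sum> (\<sigma> \<bullet> df e) df e\<close>, and the curvature term of a unit sphere is
  \<open>\<Sum> (\<sigma> \<bullet> df e) df e - |df|\<^sup>2 \<sigma>\<close>. The sums cancel, which leaves the short formula
  \<open>\<tau>\<^sub>2 = P(\<Delta> \<sigma>) + |df|\<^sup>2 \<sigma>\<close> (\<open>bitension_field_eq\<close>).

  Now let \<open>f y = Q y y\<close> with \<open>Q\<close> bilinear and symmetric, \<open>d\<close> the dimension of the source space,
  \<open>T = \<Sum> Q b b\<close> the vector of traces and \<open>s y = \<Sum> |Q y b|\<^sup>2\<close>, which is the form \<open>y\<^sup>t S y\<close>. The sphere
  condition says that \<open>|Q y y|\<^sup>2 = |y|\<^sup>4\<close>. Differentiating this identity and taking traces gives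
  everything that relates \<open>Q\<close>, \<open>T\<close> and \<open>s\<close>:

    \<^item> \<open>Q y y \<bullet> Q y h = |y|\<^sup>2 (y \<bullet> h)\<close> (one derivative),
    \<^item> \<open>T \<bullet> Q y y = (d + 2) |y|\<^sup>2 - 2 s y\<close> (two derivatives and a trace),
    \<^item> \<open>|T|\<^sup>2 + 2 tr S = d (d + 2)\<close> (one more trace).

  By the second identity \<open>\<tau> = 2 T + (4 s - 2 d - 4) f\<close> on the sphere. The right-hand side is a
  polynomial and serves as \<open>\<sigma>\<close>. Modulo multiples of \<open>f\<close>, which \<open>P\<close> annihilates, its Laplacian is
  \<open>32 Q x (S x) + 2 (4 s - 2 d - 4) T\<close>, while \<open>|df|\<^sup>2 = 4 s - 4\<close>. Inserting this into the formula
  for \<open>\<tau>\<^sub>2\<close> gives the claim, except that the coefficient of \<open>f\<close> contains \<open>4 d (d + 2)\<close>; the third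
  identity turns this into \<open>4 |T|\<^sup>2 + 8 tr S\<close>.
\<close>

section \<open>Traces, connection and curvature on the unit sphere\<close>

text \<open>
  An orthonormal basis of the tangent space at \<open>x\<close> becomes one of the whole space when \<open>x\<close> is added,
  and the trace of a bilinear map over the whole space is independent of the orthonormal basis. So
  the trace can be computed in the standard basis, whatever basis \<open>metric_trace\<close> selects. Only the
  values of \<open>B\<close> on the diagonal enter, and only these have to agree with a bilinear map.
\<close>

lemma metric_trace_sphere:
  fixes x :: "'a::euclidean_space" and B' :: "'a \<Rightarrow> 'a \<Rightarrow> 'b::euclidean_space"
  assumes x: "norm x = 1" and B': "bilinear B'"
    and eq: "\<And>e. x \<bullet> e = 0 \<Longrightarrow> norm e = 1 \<Longrightarrow> B e e = B' e e"
  shows "metric_trace (sphere 0 1) x B = (\<Sum>b\<in>Basis. B' b b) - B' x x"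
proof -
  let ?T = "tangent_space (sphere 0 1) x"
  have T: "?T = {v. x \<bullet> v = 0}" by (rule tangent_space_sphere[OF x])
  have "subspace ?T" unfolding T by (rule subspace_hyperplane)
  then have "\<exists>E. orthonormal_basis ?T E"
    unfolding orthonormal_basis_def by (metis orthonormal_basis_subspace)
  then have onb: "orthonormal_basis ?T (SOME E. orthonormal_basis ?T E)" by (rule someI_ex)
  define E where "E = (SOME E. orthonormal_basis ?T E)"
  have E: "pairwise orthogonal E" "\<And>e. e \<in> E \<Longrightarrow> norm e = 1" "span E = {v. x \<bullet> v = 0}"
    using onb by (auto simp: E_def orthonormal_basis_def T)
  have xE: "x \<bullet> e = 0" if "e \<in> E" for e
    using span_base[OF that] E(3) by auto
  let ?E = "insert x E"
  have xx: "x \<bullet> x = 1" using x by (simp add: norm_eq_1)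
  have notin: "x \<notin> E" using xE xx by auto
  have orth: "pairwise orthogonal ?E"
    using E(1) xE by (auto simp: pairwise_insert orthogonal_def inner_commute)
  have unit: "\<And>e. e \<in> ?E \<Longrightarrow> norm e = 1" using E(2) x by auto
  have fin: "finite ?E"
    by (rule pairwise_orthogonal_imp_finite[OF orth])
  have span: "v \<in> span ?E" for v
    using E(3) xx unfolding span_insert by (auto simp: inner_diff_right intro!: exI[of _ "x \<bullet> v"])
  have expand: "(\<Sum>e\<in>?E. (v \<bullet> e) *\<^sub>R e) = v" for v
    using orthonormal_basis_expand[OF orth unit span fin] .
  have lin1: "linear (\<lambda>u. B' u v)" and lin2: "linear (B' u)" for u v
    using B' by (auto simp: bilinear_def)
  have bil: "B' u v = (\<Sum>e\<in>?E. \<Sum>g\<in>?E. ((u \<bullet> e) * (v \<bullet> g)) *\<^sub>R B' e g)" for u v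
  proof -
    have "B' u v = B' (\<Sum>e\<in>?E. (u \<bullet> e) *\<^sub>R e) (\<Sum>g\<in>?E. (v \<bullet> g) *\<^sub>R g)" 
      by (simp only: expand)
    also have "\<dots> = (\<Sum>e\<in>?E. (u \<bullet> e) *\<^sub>R (\<Sum>g\<in>?E. (v \<bullet> g) *\<^sub>R B' e g))"
      by (simp only: linear_sum[OF lin1] linear_cmul[OF lin1])
        (simp only: linear_sum[OF lin2] linear_cmul[OF lin2])
    also have "\<dots> = (\<Sum>e\<in>?E. \<Sum>g\<in>?E. ((u \<bullet> e) * (v \<bullet> g)) *\<^sub>R B' e g)"
      by (simp only: scaleR_sum_right scaleR_scaleR)
    finally show ?thesis .
  qed
  \<comment> \<open>Expand both arguments in the extended basis and carry out the sum over the standard basis first.\<close>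
  have parseval: "(\<Sum>b\<in>Basis. (b \<bullet> e) * (b \<bullet> g)) = e \<bullet> g" for e g :: 'a
    by (subst euclidean_inner[of e g]) (simp add: inner_commute)
  have "(\<Sum>b\<in>Basis. B' b b)
      = (\<Sum>b\<in>Basis. \<Sum>e\<in>?E. \<Sum>g\<in>?E. ((b \<bullet> e) * (b \<bullet> g)) *\<^sub>R B' e g)"
    by (rule sum.cong[OF refl], rule bil)
  also have "\<dots> = (\<Sum>e\<in>?E. \<Sum>b\<in>Basis. \<Sum>g\<in>?E. ((b \<bullet> e) * (b \<bullet> g)) *\<^sub>R B' e g)"
    by (rule sum.swap)
  also have "\<dots> = (\<Sum>e\<in>?E. \<Sum>g\<in>?E. \<Sum>b\<in>Basis. ((b \<bullet> e) * (b \<bullet> g)) *\<^sub>R B' e g)"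
    by (rule sum.cong[OF refl], rule sum.swap)
  also have "\<dots> = (\<Sum>e\<in>?E. \<Sum>g\<in>?E. (e \<bullet> g) *\<^sub>R B' e g)"
    by (simp only: scaleR_sum_left[symmetric] parseval)
  also have "\<dots> = (\<Sum>e\<in>?E. \<Sum>g\<in>?E. if g = e then B' e e else 0)"
    using orth unit by (intro sum.cong refl) (auto simp: pairwise_def orthogonal_def norm_eq_1)
  also have "\<dots> = (\<Sum>e\<in>?E. B' e e)"
    using fin by (intro sum.cong refl) (simp add: sum.delta)
  also have "\<dots> = B' x x + (\<Sum>e\<in>E. B' e e)"
    using fin notin by simp
  also have "(\<Sum>e\<in>E. B' e e) = (\<Sum>e\<in>E. B e e)"
    using eq xE E(2) by (intro sum.cong) auto
  also have "\<dots> = metric_trace (sphere 0 1) x B"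
    by (simp add: metric_trace_def E_def)
  finally show ?thesis by simp
qed

lemma metric_trace_diff:
  "metric_trace M x (\<lambda>u v. B u v - C u v) = metric_trace M x B - metric_trace M x C"
  by (simp add: metric_trace_def sum_subtractf)

lemma differential_sphere:
  fixes x :: "'a::euclidean_space" and g :: "'a \<Rightarrow> 'b::euclidean_space"
  assumes "(g has_derivative g') (at x within sphere 0 1)"
    and "norm x = 1" "x \<bullet> u = 0"
    and "\<And>y. norm y = 1 \<Longrightarrow> f y = g y"
  shows "differential (sphere 0 1) f x u = g' u"
proof (rule differential_works)
  show "(f has_derivative g') (at x within sphere 0 1)"
    by (rule has_derivative_transform[OF _ _ assms(1)]) (use assms in auto)
  show "u \<in> tangent_space (sphere 0 1) x"
    using assms by (simp add: tangent_space_sphere)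
qed

lemma field_ext_sphere:
  "norm y = 1 \<Longrightarrow> field_ext (sphere 0 1) v y = v - (y \<bullet> v) *\<^sub>R y"
  by (simp add: field_ext_def tangent_proj_sphere)

lemma field_ext_sphere_has_derivative:
  "((\<lambda>y. v - (y \<bullet> v) *\<^sub>R y) has_derivative (\<lambda>h. - ((h \<bullet> v) *\<^sub>R x + (x \<bullet> v) *\<^sub>R h))) (at x within M)"
  by (auto intro!: derivative_eq_intros simp: inner_commute)

lemma levi_civita_field_ext_sphere:
  fixes x :: "'a::euclidean_space"
  assumes x: "norm x = 1" and u: "x \<bullet> u = 0"
  shows "levi_civita (sphere 0 1) (field_ext (sphere 0 1) v) x u = - (x \<bullet> v) *\<^sub>R u"
proof -
  have "differential (sphere 0 1) (field_ext (sphere 0 1) v) x u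
      = - ((u \<bullet> v) *\<^sub>R x + (x \<bullet> v) *\<^sub>R u)"
    by (rule differential_sphere[OF field_ext_sphere_has_derivative x u]) (simp add: field_ext_sphere)
  moreover have "x \<bullet> x = 1" using x by (simp add: norm_eq_1)
  ultimately show ?thesis
    by (simp add: levi_civita_def tangent_proj_sphere x u inner_diff_right inner_add_right)
qed

text \<open>
  Extend a tangent vector \<open>a\<close> to the field \<open>y \<mapsto> P\<^bsub>y\<^esub> a\<close>. The derivative of such a field at \<open>p\<close> is
  normal, so its covariant derivative vanishes at \<open>p\<close>, and so does the Lie bracket of two such
  fields. The curvature therefore comes from the iterated covariant derivatives alone, and
  \<open>\<nabla>\<^sub>W Z = - (y \<bullet> w) W\<close> for the extension \<open>Z\<close> of \<open>w\<close>.
\<close>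

lemma curvature_sphere:
  fixes p :: "'a::euclidean_space"
  assumes p: "norm p = 1" and u: "p \<bullet> u = 0" and v: "p \<bullet> v = 0" and w: "p \<bullet> w = 0"
  shows "curvature (sphere 0 1) p u v w = (v \<bullet> w) *\<^sub>R u - (u \<bullet> w) *\<^sub>R v"
proof -
  let ?S = "sphere (0::'a) 1"
  have pp: "p \<bullet> p = 1" using p by (simp add: norm_eq_1)
  have val: "field_ext ?S a p = a" if "p \<bullet> a = 0" for a
    using that by (simp add: field_ext_sphere p)
  have iter: "levi_civita ?S (\<lambda>y. levi_civita ?S (field_ext ?S w) y (field_ext ?S a y)) p b
      = - (b \<bullet> w) *\<^sub>R a" if a: "p \<bullet> a = 0" and b: "p \<bullet> b = 0" for a b
  proof -
    have on: "levi_civita ?S (field_ext ?S w) y (field_ext ?S a y)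
        = - (y \<bullet> w) *\<^sub>R (a - (y \<bullet> a) *\<^sub>R y)" if y: "norm y = 1" for y
    proof -
      have "y \<bullet> y = 1" using y by (simp add: norm_eq_1)
      then show ?thesis
        by (subst levi_civita_field_ext_sphere[OF y])
          (simp_all add: field_ext_sphere y inner_diff_right)
    qed
    have "((\<lambda>y. - (y \<bullet> w) *\<^sub>R (a - (y \<bullet> a) *\<^sub>R y)) has_derivative
        (\<lambda>h. - (h \<bullet> w) *\<^sub>R a)) (at p within ?S)"
      using a w
      by (auto intro!: derivative_eq_intros field_ext_sphere_has_derivative simp: inner_commute)
    from differential_sphere[OF this p b on]
    show ?thesis using a by (simp add: levi_civita_def tangent_proj_sphere p)
  qed
  have D: "differential ?S (field_ext ?S a) p b = - (b \<bullet> a) *\<^sub>R p"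
    if "p \<bullet> a = 0" "p \<bullet> b = 0" for a b
    using differential_sphere[OF field_ext_sphere_has_derivative p that(2) field_ext_sphere] that(1)
    by simp
  have "lie_bracket ?S (field_ext ?S u) (field_ext ?S v) p = 0"
    using u v by (simp add: lie_bracket_def val D inner_commute)
  moreover have "levi_civita ?S (field_ext ?S w) p 0 = 0"
    using levi_civita_field_ext_sphere[OF p, of 0 w] by simp
  ultimately show ?thesis
    using u v w by (simp add: curvature_def curvature_fields_def val iter)
qed

section \<open>Restricting a twice differentiable map to the sphere\<close>

text \<open>
  The second derivative is recorded one direction \<open>w\<close> at a time, so that \<open>G'\<close> need not be
  differentiated as a map into a space of linear maps. Bilinearity of \<open>G''\<close> follows from uniqueness
  of derivatives.
\<close>

definition has_two_derivatives ::
    "('a::euclidean_space \<Rightarrow> 'b::euclidean_space) \<Rightarrow> ('a \<Rightarrow> 'a \<Rightarrow> 'b) \<Rightarrow> ('a \<Rightarrow> 'a \<Rightarrow> 'a \<Rightarrow> 'b) \<Rightarrow> bool"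
  where "has_two_derivatives G G' G'' \<longleftrightarrow>
    (\<forall>y. (G has_derivative G' y) (at y)) \<and>
    (\<forall>y w. ((\<lambda>z. G' z w) has_derivative (\<lambda>h. G'' y h w)) (at y))"

context
  fixes G :: "'a::euclidean_space \<Rightarrow> 'b::euclidean_space" and G' G''
  assumes G: "has_two_derivatives G G' G''"
begin

lemma first_derivative: "(G has_derivative G' y) (at y within M)"
  using G has_derivative_at_withinI unfolding has_two_derivatives_def by blast

lemma linear_first_derivative: "linear (G' y)"
  using first_derivative has_derivative_linear by blast

lemma second_derivative: "((\<lambda>z. G' z w) has_derivative (\<lambda>h. G'' y h w)) (at y within M)"
  using G has_derivative_at_withinI unfolding has_two_derivatives_def by blast

lemma bilinear_second_derivative: "bilinear (G'' y)"
  unfolding bilinear_def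
proof (intro conjI allI)
  show "linear (\<lambda>h. G'' y h w)" for w
    using second_derivative has_derivative_linear by blast
  show "linear (G'' y h)" for h
  proof (rule linearI)
    fix v w :: 'a and c :: real
    have "((\<lambda>z. G' z (v + w)) has_derivative (\<lambda>h. G'' y h v + G'' y h w)) (at y)"
      unfolding linear_add[OF linear_first_derivative]
      by (intro has_derivative_add second_derivative)
    from has_derivative_unique[OF second_derivative this]
    show "G'' y h (v + w) = G'' y h v + G'' y h w" by (rule fun_cong)
    have "((\<lambda>z. G' z (c *\<^sub>R w)) has_derivative (\<lambda>h. c *\<^sub>R G'' y h w)) (at y)"
      unfolding linear_cmul[OF linear_first_derivative]
      by (intro has_derivative_scaleR_right second_derivative)
    from has_derivative_unique[OF second_derivative this]
    show "G'' y h (c *\<^sub>R w) = c *\<^sub>R G'' y h w" by (rule fun_cong)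
  qed
qed

text \<open>
  The product rule for the pairing of the derivative of \<open>G\<close> with a vector field, obtained by writing
  the field in coordinates: the coefficients vary, the directions of differentiation are fixed.
\<close>

lemma has_derivative_along_field:
  assumes W: "(W has_derivative W') (at x within M)"
  shows "((\<lambda>y. G' y (W y)) has_derivative (\<lambda>h. G'' x h (W x) + G' x (W' h))) (at x within M)"
proof -
  have coords: "L w = (\<Sum>b\<in>Basis. (w \<bullet> b) *\<^sub>R L b)" if "linear L" for L :: "'a \<Rightarrow> 'b" and w
    by (subst euclidean_representation[of w, symmetric])
      (simp only: linear_sum[OF that] linear_cmul[OF that])
  have lin: "linear (G'' x h)" for h
    using bilinear_second_derivative by (simp add: bilinear_def)
  have "((\<lambda>y. \<Sum>b\<in>Basis. (W y \<bullet> b) *\<^sub>R G' y b) has_derivative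
      (\<lambda>h. \<Sum>b\<in>Basis. (W x \<bullet> b) *\<^sub>R G'' x h b + (W' h \<bullet> b) *\<^sub>R G' x b)) (at x within M)"
    by (intro has_derivative_sum has_derivative_scaleR second_derivative has_derivative_inner_left W)
  then show ?thesis
    by (simp add: sum.distrib coords[OF linear_first_derivative, of _ "W _"]
        coords[OF linear_first_derivative, of _ "W' _"] coords[OF lin, of _ "W x"])
qed

text \<open>
  The derivative of \<open>dG\<close> applied to the tangential extension of \<open>v\<close>. For tangent \<open>h\<close> this is the
  Hessian of the restriction of \<open>G\<close> to the sphere, because the extending field is covariantly
  constant at \<open>x\<close>; the term with \<open>G' x x\<close> reflects the second fundamental form of the sphere.
\<close>

lemma has_derivative_along_projected_field:
  assumes x: "norm x = 1" and v: "x \<bullet> v = 0"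
  shows "((\<lambda>y. G' y (v - (y \<bullet> v) *\<^sub>R y)) has_derivative
    (\<lambda>h. G'' x h v - (h \<bullet> v) *\<^sub>R G' x x)) (at x within M)"
proof -
  show ?thesis
    using has_derivative_along_field[OF field_ext_sphere_has_derivative[of v x M]] v
    by (simp add: linear_neg[OF linear_first_derivative] linear_cmul[OF linear_first_derivative])
qed

lemma sphere_hessian_bilinear: "bilinear (\<lambda>u v. G'' x u v - (u \<bullet> v) *\<^sub>R G' x x)"
  using bilinear_second_derivative[of x]
  by (auto simp: bilinear_def linear_iff algebra_simps inner_add_left inner_add_right)

end

text \<open>
  The trace over the tangent space at a unit vector \<open>x\<close> of the Hessian
  \<open>G'' x u v - (u \<bullet> v) *\<^sub>R G' x x\<close>, that is, the Laplacian of the restriction of \<open>G\<close> to the sphere.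
\<close>

definition sphere_laplacian ::
    "('a::euclidean_space \<Rightarrow> 'a \<Rightarrow> 'b::euclidean_space) \<Rightarrow> ('a \<Rightarrow> 'a \<Rightarrow> 'a \<Rightarrow> 'b) \<Rightarrow> 'a \<Rightarrow> 'b"
  where "sphere_laplacian G' G'' x =
    (\<Sum>b\<in>Basis. G'' x b b) - G'' x x x - (real DIM('a) - 1) *\<^sub>R G' x x"

section \<open>Tension and bitension of maps between spheres\<close>

text \<open>
  The map \<open>\<phi>\<close> between the spheres has prescribed values on the unit sphere only. Its extension \<open>f\<close> is
  the map to which ordinary calculus applies.
\<close>

locale sphere_map =
  fixes f :: "'a::euclidean_space \<Rightarrow> 'b::euclidean_space" and f' f'' \<phi>
  assumes derivs: "has_two_derivatives f f' f''"
    and unit: "\<And>y. norm y = 1 \<Longrightarrow> norm (f y) = 1"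
    and restrict: "\<And>y. norm y = 1 \<Longrightarrow> \<phi> y = f y"
begin

lemma differential_phi:
  "norm y = 1 \<Longrightarrow> y \<bullet> u = 0 \<Longrightarrow> differential (sphere 0 1) \<phi> y u = f' y u"
  by (rule differential_sphere[OF first_derivative[OF derivs] _ _ restrict])

lemma image_tangent:
  assumes y: "norm y = 1" and u: "y \<bullet> u = 0"
  shows "f y \<bullet> f' y u = 0"
proof -
  have "((\<lambda>y. f y \<bullet> f y) has_derivative (\<lambda>h. f y \<bullet> f' y h + f' y h \<bullet> f y)) (at y within sphere 0 1)"
    by (intro has_derivative_inner first_derivative[OF derivs])
  from differential_sphere[OF this y u, of "\<lambda>_. 1"]
  have "differential (sphere 0 1) (\<lambda>_. 1) y u = 2 * (f y \<bullet> f' y u)"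
    using unit by (simp add: norm_eq_1 inner_commute)
  moreover have "differential (sphere 0 1) (\<lambda>_. 1 :: real) y u = 0"
    by (rule differential_sphere[OF has_derivative_const y u]) simp
  ultimately show ?thesis by simp
qed

text \<open>
  Both trace computations, for the tension and for the bitension field, lead to a projected Hessian
  plus a bilinear remainder \<open>C\<close>; projection and trace commute.
\<close>

lemma trace_projected_hessian:
  assumes x: "norm x = 1" and H: "has_two_derivatives G G' G''"
    and C: "bilinear C"
    and eq: "\<And>e. x \<bullet> e = 0 \<Longrightarrow> norm e = 1 \<Longrightarrow>
      B e e = tangent_proj (sphere 0 1) (f x) (G'' x e e - (e \<bullet> e) *\<^sub>R G' x x) + C e e"
  shows "metric_trace (sphere 0 1) x B =
    tangent_proj (sphere 0 1) (f x) (sphere_laplacian G' G'' x) + (\<Sum>b\<in>Basis. C b b) - C x x"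
proof -
  define P where "P = (\<lambda>v. v - (f x \<bullet> v) *\<^sub>R f x)"
  have P: "tangent_proj (sphere 0 1) (f x) v = P v" for v
    using unit[OF x] by (simp add: tangent_proj_sphere P_def)
  have linP: "linear P"
    by (rule linearI) (simp_all add: P_def algebra_simps inner_add_right)
  have xx: "x \<bullet> x = 1" using x by (simp add: norm_eq_1)
  let ?H = "\<lambda>u v. G'' x u v - (u \<bullet> v) *\<^sub>R G' x x"
  have "bilinear (\<lambda>u v. P (?H u v) + C u v)"
    using sphere_hessian_bilinear[OF H, of x] C linP
    by (auto simp: bilinear_def intro!: linear_compose_add linear_compose[of _ P, unfolded o_def])
  from metric_trace_sphere[OF x this] eq
  have "metric_trace (sphere 0 1) x B = (\<Sum>b\<in>Basis. P (?H b b) + C b b) - (P (?H x x) + C x x)"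
    by (simp add: P)
  also have "\<dots> = P ((\<Sum>b\<in>Basis. ?H b b) - ?H x x) + (\<Sum>b\<in>Basis. C b b) - C x x"
    by (simp add: sum.distrib linear_diff[OF linP] linear_sum[OF linP])
  also have "(\<Sum>b\<in>Basis. ?H b b) - ?H x x = sphere_laplacian G' G'' x"
    by (simp add: sphere_laplacian_def sum_subtractf xx inner_Basis sum_constant_scaleR algebra_simps
        del: sum_constant)
  finally show ?thesis by (simp add: P)
qed

lemma tension_field_eq:
  assumes x: "norm x = 1"
  shows "tension_field (sphere 0 1) (sphere 0 1) \<phi> x =
    tangent_proj (sphere 0 1) (f x) (sphere_laplacian f' f'' x)"
proof -
  have sff: "second_fundamental_form (sphere 0 1) (sphere 0 1) \<phi> x e e =
      tangent_proj (sphere 0 1) (f x) (f'' x e e - (e \<bullet> e) *\<^sub>R f' x x)"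
    if e: "x \<bullet> e = 0" for e
  proof -
    have on: "differential (sphere 0 1) \<phi> y (field_ext (sphere 0 1) e y)
        = f' y (e - (y \<bullet> e) *\<^sub>R y)" if y: "norm y = 1" for y
    proof -
      have "y \<bullet> y = 1" using y by (simp add: norm_eq_1)
      then show ?thesis
        by (subst differential_phi[OF y]) (simp_all add: field_ext_sphere y inner_diff_right)
    qed
    have "levi_civita (sphere 0 1) (field_ext (sphere 0 1) e) x e = 0"
      using e by (simp add: levi_civita_field_ext_sphere x)
    moreover have "f' x 0 = 0" by (rule linear_0[OF linear_first_derivative[OF derivs]])
    ultimately show ?thesis
      using differential_sphere[OF has_derivative_along_projected_field[OF derivs x e] x e on]
      by (simp add: second_fundamental_form_def pullback_conn_def differential_phi x restrict)
  qed
  have "bilinear (\<lambda>(u::'a) (v::'a). 0 :: 'b)"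
    by (simp add: bilinear_def linear_iff)
  from trace_projected_hessian[OF x derivs this, of "second_fundamental_form (sphere 0 1) (sphere 0 1) \<phi> x"]
  show ?thesis using sff by (simp add: tension_field_def)
qed

text \<open>
  The inner covariant derivative subtracts the normal component \<open>(f \<bullet> ds) f\<close>. Differentiating this
  product and projecting leaves only the derivative of its second factor, \<open>- (f \<bullet> ds e) df e\<close>, and
  differentiating \<open>f \<bullet> s = 0\<close> identifies \<open>- f \<bullet> ds e\<close> with \<open>s \<bullet> df e\<close>.
\<close>

lemma second_cov_deriv_eq:
  assumes x: "norm x = 1" and e: "x \<bullet> e = 0"
    and s: "has_two_derivatives s s' s''"
    and ext: "\<And>y. norm y = 1 \<Longrightarrow> \<sigma> y = s y"
    and tangent: "\<And>y. norm y = 1 \<Longrightarrow> f y \<bullet> s y = 0"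
  shows "second_cov_deriv (sphere 0 1) (sphere 0 1) \<phi> \<sigma> x e e =
    tangent_proj (sphere 0 1) (f x) (s'' x e e - (e \<bullet> e) *\<^sub>R s' x x)
    + (s x \<bullet> f' x e) *\<^sub>R f' x e"
proof -
  let ?w = "\<lambda>y. s' y (e - (y \<bullet> e) *\<^sub>R y)"
  have P: "tangent_proj (sphere 0 1) (\<phi> y) v = v - (f y \<bullet> v) *\<^sub>R f y" if "norm y = 1" for y v
    using that by (simp add: tangent_proj_sphere unit restrict)
  have conn: "pullback_conn (sphere 0 1) (sphere 0 1) \<phi> \<sigma> y u = s' y u - (f y \<bullet> s' y u) *\<^sub>R f y"
    if y: "norm y = 1" and u: "y \<bullet> u = 0" for y u
    by (simp add: pullback_conn_def P y differential_sphere[OF first_derivative[OF s] y u ext])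
  have on: "pullback_conn (sphere 0 1) (sphere 0 1) \<phi> \<sigma> y (field_ext (sphere 0 1) e y)
      = ?w y - (f y \<bullet> ?w y) *\<^sub>R f y" if y: "norm y = 1" for y
  proof -
    have "y \<bullet> y = 1" using y by (simp add: norm_eq_1)
    then show ?thesis
      by (subst conn[OF y]) (simp_all add: field_ext_sphere y inner_diff_right)
  qed
  have normal: "f x \<bullet> s' x e = - (s x \<bullet> f' x e)"
  proof -
    have "((\<lambda>y. f y \<bullet> s y) has_derivative (\<lambda>h. f x \<bullet> s' x h + f' x h \<bullet> s x)) (at x within sphere 0 1)"
      by (intro has_derivative_inner first_derivative[OF derivs] first_derivative[OF s])
    from differential_sphere[OF this x e, of "\<lambda>_. 0"]
    have "differential (sphere 0 1) (\<lambda>_. 0) x e = f x \<bullet> s' x e + f' x e \<bullet> s x"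
      using tangent by simp
    moreover have "differential (sphere 0 1) (\<lambda>_. 0 :: real) x e = 0"
      by (rule differential_sphere[OF has_derivative_const x e]) simp
    ultimately show ?thesis by (simp add: inner_commute)
  qed
  let ?H = "s'' x e e - (e \<bullet> e) *\<^sub>R s' x x"
  have w: "(?w has_derivative (\<lambda>h. s'' x h e - (h \<bullet> e) *\<^sub>R s' x x)) (at x within sphere 0 1)"
    by (rule has_derivative_along_projected_field[OF s x e])
  have "((\<lambda>y. ?w y - (f y \<bullet> ?w y) *\<^sub>R f y) has_derivative
      (\<lambda>h. (s'' x h e - (h \<bullet> e) *\<^sub>R s' x x) - ((f x \<bullet> ?w x) *\<^sub>R f' x h +
        (f x \<bullet> (s'' x h e - (h \<bullet> e) *\<^sub>R s' x x) + f' x h \<bullet> ?w x) *\<^sub>R f x)))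
      (at x within sphere 0 1)"
    by (intro has_derivative_diff has_derivative_scaleR has_derivative_inner w
        first_derivative[OF derivs])
  from differential_sphere[OF this x e on] e
  have D: "differential (sphere 0 1) (\<lambda>y. pullback_conn (sphere 0 1) (sphere 0 1) \<phi> \<sigma> y
        (field_ext (sphere 0 1) e y)) x e
      = ?H + (s x \<bullet> f' x e) *\<^sub>R f' x e - (f x \<bullet> ?H + f' x e \<bullet> s' x e) *\<^sub>R f x"
    by (simp add: normal)
  have "levi_civita (sphere 0 1) (field_ext (sphere 0 1) e) x e = 0"
    using e by (simp add: levi_civita_field_ext_sphere x)
  moreover have "s' x 0 = 0" by (rule linear_0[OF linear_first_derivative[OF s]])
  moreover have "f x \<bullet> f x = 1" using unit[OF x] by (simp add: norm_eq_1)
  moreover have "f x \<bullet> f' x e = 0" by (rule image_tangent[OF x e])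
  ultimately show ?thesis
    unfolding second_cov_deriv_def pullback_conn_def[of _ _ _ _ x e] D
    by (simp add: conn x P restrict[OF x, symmetric] inner_diff_right inner_add_right)
      (simp add: restrict x algebra_simps)
qed

text \<open>
  The curvature term \<open>(s \<bullet> df e) df e - (df e \<bullet> df e) s\<close> cancels the terms \<open>(s \<bullet> df e) df e\<close> of the
  second covariant derivative. Both traces are taken in the same basis, so they can be combined
  before either is evaluated.
\<close>

lemma bitension_field_eq:
  assumes x: "norm x = 1"
    and s: "has_two_derivatives s s' s''"
    and ext: "\<And>y. norm y = 1 \<Longrightarrow> tension_field (sphere 0 1) (sphere 0 1) \<phi> y = s y"
  shows "bitension_field (sphere 0 1) (sphere 0 1) \<phi> x =
    tangent_proj (sphere 0 1) (f x) (sphere_laplacian s' s'' x)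
    + ((\<Sum>b\<in>Basis. f' x b \<bullet> f' x b) - f' x x \<bullet> f' x x) *\<^sub>R s x"
proof -
  have tangent: "f y \<bullet> s y = 0" if y: "norm y = 1" for y
  proof -
    have "f y \<bullet> f y = 1" using unit[OF y] by (simp add: norm_eq_1)
    then show ?thesis
      by (simp add: ext[OF y, symmetric] tension_field_eq[OF y] tangent_proj_sphere unit y inner_diff_right)
  qed
  let ?C = "\<lambda>u v. (f' x u \<bullet> f' x v) *\<^sub>R s x"
  let ?R = "\<lambda>u v. curvature (sphere 0 1) (\<phi> x) (differential (sphere 0 1) \<phi> x u)
      (tension_field (sphere 0 1) (sphere 0 1) \<phi> x) (differential (sphere 0 1) \<phi> x v)"
  have R: "?R e e = (s x \<bullet> f' x e) *\<^sub>R f' x e - ?C e e" if e: "x \<bullet> e = 0" for e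
    using e x by (simp add: differential_phi ext restrict curvature_sphere unit image_tangent tangent)
  have "bilinear ?C"
    using linear_first_derivative[OF derivs, of x]
    by (auto simp: bilinear_def linear_iff algebra_simps inner_add_left inner_add_right)
  note tr = trace_projected_hessian[OF x s this, of
      "\<lambda>u v. second_cov_deriv (sphere 0 1) (sphere 0 1) \<phi>
        (tension_field (sphere 0 1) (sphere 0 1) \<phi>) x u v - ?R u v"]
  have "bitension_field (sphere 0 1) (sphere 0 1) \<phi> x =
      metric_trace (sphere 0 1) x (\<lambda>u v. second_cov_deriv (sphere 0 1) (sphere 0 1) \<phi>
        (tension_field (sphere 0 1) (sphere 0 1) \<phi>) x u v - ?R u v)"
    by (simp add: bitension_field_def rough_laplacian_def metric_trace_diff)
  also have "\<dots> = tangent_proj (sphere 0 1) (f x) (sphere_laplacian s' s'' x)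
      + (\<Sum>b\<in>Basis. ?C b b) - ?C x x"
    by (rule tr) (simp add: R second_cov_deriv_eq[OF x _ s ext tangent])
  finally show ?thesis
    by (simp add: scaleR_sum_left scaleR_diff_left)
qed

end

section \<open>Quadratic maps between spheres\<close>

text \<open>
  The quadratic map is given by its symmetric polar form \<open>Q\<close>. In terms of matrices,
  \<open>Q u v = (u\<^sup>t A\<^sub>k v)\<^sub>k\<close>, and \<open>trace_Q\<close>, \<open>gram\<close> and \<open>gram_op\<close> below are the vector of the traces of the
  \<open>A\<^sub>k\<close>, the bilinear form of \<open>S = \<Sum> A\<^sub>k\<^sup>2\<close> and the linear map \<open>S\<close>.
\<close>

locale spherical_quadratic =
  fixes Q :: "'a::euclidean_space \<Rightarrow> 'a \<Rightarrow> 'b::euclidean_space"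
  assumes bilinear_Q: "bilinear Q"
    and sym_Q: "Q u v = Q v u"
    and unit_Q: "norm y = 1 \<Longrightarrow> norm (Q y y) = 1"
begin

definition trace_Q :: 'b where "trace_Q = (\<Sum>b\<in>Basis. Q b b)"

definition gram :: "'a \<Rightarrow> 'a \<Rightarrow> real" where "gram u v = (\<Sum>b\<in>Basis. Q u b \<bullet> Q v b)"

definition gram_op :: "'a \<Rightarrow> 'a" where "gram_op x = (\<Sum>b\<in>Basis. gram x b *\<^sub>R b)"

lemma bounded_bilinear_Q: "bounded_bilinear Q"
  using bilinear_Q by (simp add: bilinear_conv_bounded_bilinear)

lemmas has_derivative_Q = bounded_bilinear.FDERIV[OF bounded_bilinear_Q]
lemmas Q_simps = bounded_bilinear.add_left[OF bounded_bilinear_Q]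
  bounded_bilinear.add_right[OF bounded_bilinear_Q]
  bounded_bilinear.scaleR_left[OF bounded_bilinear_Q]
  bounded_bilinear.scaleR_right[OF bounded_bilinear_Q]
  bounded_bilinear.zero_left[OF bounded_bilinear_Q]
  bounded_bilinear.zero_right[OF bounded_bilinear_Q]

lemma bounded_bilinear_gram: "bounded_bilinear gram"
proof -
  have "bilinear gram"
    by (auto simp: bilinear_def linear_iff gram_def Q_simps inner_add_left inner_add_right
        sum.distrib sum_distrib_left)
  then show ?thesis by (simp add: bilinear_conv_bounded_bilinear)
qed

lemmas has_derivative_gram = bounded_bilinear.FDERIV[OF bounded_bilinear_gram]

lemma gram_commute: "gram u v = gram v u"
  by (simp add: gram_def inner_commute)

lemma inner_gram_op: "h \<bullet> gram_op x = gram x h"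
proof -
  have "gram x h = gram x (\<Sum>b\<in>Basis. (h \<bullet> b) *\<^sub>R b)" by (simp add: euclidean_representation)
  also have "\<dots> = (\<Sum>b\<in>Basis. (h \<bullet> b) * gram x b)"
    by (simp add: bounded_bilinear.sum_right[OF bounded_bilinear_gram]
        bounded_bilinear.scaleR_right[OF bounded_bilinear_gram])
  also have "\<dots> = h \<bullet> gram_op x"
    by (simp add: gram_op_def inner_sum_right mult.commute)
  finally show ?thesis by simp
qed

lemma inner_Q_diag_diag: "Q y y \<bullet> Q y y = (y \<bullet> y)\<^sup>2"
proof (cases "y = 0")
  case True
  then show ?thesis by (simp add: Q_simps)
next
  case False
  define z where "z = y /\<^sub>R norm y"
  have "norm z = 1" using False by (simp add: z_def)
  moreover have y: "y = norm y *\<^sub>R z" using False by (simp add: z_def)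
  ultimately have "Q z z \<bullet> Q z z = 1" "z \<bullet> z = 1" using unit_Q by (simp_all add: norm_eq_1)
  then show ?thesis
    by (subst (1 2 3 4 5 6) y) (simp add: Q_simps power2_eq_square)
qed

text \<open>The derivative of \<open>|Q y y|\<^sup>2 = |y|\<^sup>4\<close> in the direction \<open>h\<close>, divided by four.\<close>

lemma inner_Q_diag_polar: "Q y y \<bullet> Q y h = (y \<bullet> y) * (y \<bullet> h)"
proof -
  have "((\<lambda>y. Q y y \<bullet> Q y y) has_derivative
      (\<lambda>h. Q y y \<bullet> (Q y h + Q h y) + (Q y h + Q h y) \<bullet> Q y y)) (at y)"
    by (intro has_derivative_inner has_derivative_Q has_derivative_ident)
  moreover have "((\<lambda>y. (y \<bullet> y)\<^sup>2) has_derivative (\<lambda>h. 4 * (y \<bullet> y) * (y \<bullet> h))) (at y)"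
    by (auto intro!: derivative_eq_intros simp: inner_commute)
  ultimately have "(\<lambda>h. Q y y \<bullet> (Q y h + Q h y) + (Q y h + Q h y) \<bullet> Q y y)
      = (\<lambda>h. 4 * (y \<bullet> y) * (y \<bullet> h))"
    unfolding inner_Q_diag_diag by (rule has_derivative_unique)
  from fun_cong[OF this, of h] show ?thesis
    by (simp add: sym_Q inner_add_right inner_add_left inner_commute)
qed

text \<open>
  The derivative of the preceding identity with respect to \<open>y\<close>, in the same direction \<open>h\<close> that is
  already fixed in it.
\<close>

lemma inner_Q_polarized:
  "2 * (Q y h \<bullet> Q y h) + Q y y \<bullet> Q h h = 2 * (y \<bullet> h)\<^sup>2 + (y \<bullet> y) * (h \<bullet> h)"
proof -
  have "((\<lambda>y. Q y y \<bullet> Q y h) has_derivative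
      (\<lambda>k. Q y y \<bullet> (Q y 0 + Q k h) + (Q y k + Q k y) \<bullet> Q y h)) (at y)"
    by (intro has_derivative_inner has_derivative_Q has_derivative_ident has_derivative_const)
  moreover have "((\<lambda>y. (y \<bullet> y) * (y \<bullet> h)) has_derivative
      (\<lambda>k. 2 * (y \<bullet> k) * (y \<bullet> h) + (y \<bullet> y) * (k \<bullet> h))) (at y)"
    by (auto intro!: derivative_eq_intros simp: inner_commute)
  ultimately have "(\<lambda>k. Q y y \<bullet> (Q y 0 + Q k h) + (Q y k + Q k y) \<bullet> Q y h)
      = (\<lambda>k. 2 * (y \<bullet> k) * (y \<bullet> h) + (y \<bullet> y) * (k \<bullet> h))"
    unfolding inner_Q_diag_polar by (rule has_derivative_unique)
  from fun_cong[OF this, of h] show ?thesis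
    by (simp add: sym_Q Q_simps inner_add_left power2_eq_square)
qed

text \<open>The trace of the preceding identity over \<open>h\<close>.\<close>

lemma inner_trace_Q_diag: "trace_Q \<bullet> Q y y = (real DIM('a) + 2) * (y \<bullet> y) - 2 * gram y y"
proof -
  have "(\<Sum>b\<in>Basis. 2 * (Q y b \<bullet> Q y b) + Q y y \<bullet> Q b b)
      = (\<Sum>b\<in>Basis. 2 * (y \<bullet> b)\<^sup>2 + (y \<bullet> y) * (b \<bullet> b))"
    by (simp only: inner_Q_polarized)
  then have "2 * gram y y + trace_Q \<bullet> Q y y
      = 2 * (\<Sum>b\<in>Basis. (y \<bullet> b)\<^sup>2) + (y \<bullet> y) * real DIM('a)"
    by (simp add: sum.distrib sum_distrib_left gram_def trace_Q_def inner_sum_right inner_Basis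
        inner_commute[of "sum _ _"])
  moreover have "(\<Sum>b\<in>Basis. (y \<bullet> b)\<^sup>2) = y \<bullet> y"
    by (subst euclidean_inner[of y y]) (simp add: power2_eq_square)
  ultimately show ?thesis by (simp add: algebra_simps)
qed

text \<open>The trace of the preceding identity, now over \<open>y\<close>.\<close>

lemma inner_trace_Q_self:
  "trace_Q \<bullet> trace_Q + 2 * (\<Sum>b\<in>Basis. gram b b) = (real DIM('a) + 2) * real DIM('a)"
proof -
  have "trace_Q \<bullet> trace_Q = (\<Sum>b\<in>Basis. trace_Q \<bullet> Q b b)"
    by (subst (2) trace_Q_def) (simp add: inner_sum_right)
  also have "\<dots> = (\<Sum>b\<in>(Basis::'a set). (real DIM('a) + 2) * (b \<bullet> b) - 2 * gram b b)"
    by (simp only: inner_trace_Q_diag)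
  also have "\<dots> = (real DIM('a) + 2) * real DIM('a) - 2 * (\<Sum>b\<in>Basis. gram b b)"
    by (simp add: sum_subtractf sum_distrib_left inner_Basis algebra_simps)
  finally show ?thesis by simp
qed

lemma two_derivatives_Q:
  "has_two_derivatives (\<lambda>y. Q y y) (\<lambda>y h. 2 *\<^sub>R Q y h) (\<lambda>y h w. 2 *\<^sub>R Q h w)"
  unfolding has_two_derivatives_def
proof (intro conjI allI)
  show "((\<lambda>y. Q y y) has_derivative (\<lambda>h. 2 *\<^sub>R Q y h)) (at y)" for y
    using has_derivative_Q[OF has_derivative_ident has_derivative_ident, of y]
    by (simp add: sym_Q scaleR_2)
  show "((\<lambda>z. 2 *\<^sub>R Q z w) has_derivative (\<lambda>h. 2 *\<^sub>R Q h w)) (at y)" for y w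
    using has_derivative_scaleR_right[OF has_derivative_Q[OF has_derivative_ident has_derivative_const]]
    by (simp add: Q_simps)
qed

text \<open>
  For \<open>c = 2 d + 4\<close>, where \<open>d\<close> is the dimension of the source space, the polynomial below agrees with
  the tension field on the unit sphere.
\<close>

lemma two_derivatives_tension:
  "has_two_derivatives (\<lambda>y. 2 *\<^sub>R trace_Q + (4 * gram y y - c) *\<^sub>R Q y y)
    (\<lambda>y h. (8 * gram y h) *\<^sub>R Q y y + (2 * (4 * gram y y - c)) *\<^sub>R Q y h)
    (\<lambda>y h w. (8 * gram h w) *\<^sub>R Q y y + (16 * gram y w) *\<^sub>R Q y h + (16 * gram y h) *\<^sub>R Q y w
      + (2 * (4 * gram y y - c)) *\<^sub>R Q h w)"
proof -
  have g: "((\<lambda>y. gram y y) has_derivative (\<lambda>h. 2 * gram y h)) (at y)" for y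
    using has_derivative_gram[OF has_derivative_ident has_derivative_ident, of y]
    by (simp add: gram_commute)
  have gw: "((\<lambda>y. gram y w) has_derivative (\<lambda>h. gram h w)) (at y)" for y w
    by (rule bounded_linear_imp_has_derivative[OF
          bounded_bilinear.bounded_linear_left[OF bounded_bilinear_gram]])
  have q: "((\<lambda>y. Q y y) has_derivative (\<lambda>h. 2 *\<^sub>R Q y h)) (at y)" for y
    by (rule first_derivative[OF two_derivatives_Q])
  have qw: "((\<lambda>y. Q y w) has_derivative (\<lambda>h. Q h w)) (at y)" for y w
    by (rule bounded_linear_imp_has_derivative[OF
          bounded_bilinear.bounded_linear_left[OF bounded_bilinear_Q]])
  show ?thesis
    unfolding has_two_derivatives_def
    by (intro conjI allI; rule has_derivative_eq_rhs)
      (auto intro!: derivative_eq_intros g gw q qw simp: algebra_simps)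
qed

text \<open>
  The statement for a quadratic map given by its polar form. The general formula
  \<open>P(\<Delta> \<sigma>) + |df|\<^sup>2 \<sigma>\<close> is applied to the polynomial extension \<open>\<sigma>\<close> of the tension field. The
  dimension of the source sphere is \<open>DIM('a) - 1\<close>, which accounts for the constants.
\<close>

lemma bitension_field_quadratic:
  assumes phi: "\<And>y. norm y = 1 \<Longrightarrow> \<phi> y = Q y y"
    and x: "norm x = 1"
  shows "bitension_field (sphere 0 1) (sphere 0 1) \<phi> x =
      - (4 * (real DIM('a) + 4 - 4 * gram x x)) *\<^sub>R trace_Q
      + (8 * (\<Sum>b\<in>Basis. gram b b) + 4 * (trace_Q \<bullet> trace_Q)
          - 8 * (3 * real DIM('a) + 12) * gram x x
          + 32 * (gram x x)\<^sup>2 + 16 * (real DIM('a) + 2)) *\<^sub>R Q x x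
      + 32 *\<^sub>R Q x (gram_op x)"
proof -
  interpret sphere_map "\<lambda>y. Q y y" "\<lambda>y h. 2 *\<^sub>R Q y h" "\<lambda>y h w. 2 *\<^sub>R Q h w" \<phi>
    by unfold_locales (simp_all add: two_derivatives_Q unit_Q phi)
  define c where "c = 2 * real DIM('a) + 4"
  let ?g = "gram x x" and ?d = "real DIM('a)"
  have P: "tangent_proj (sphere 0 1) (Q y y) v = v - (Q y y \<bullet> v) *\<^sub>R Q y y" if "norm y = 1" for y v
    using that by (simp add: tangent_proj_sphere unit_Q)
  have tension: "tension_field (sphere 0 1) (sphere 0 1) \<phi> y
      = 2 *\<^sub>R trace_Q + (4 * gram y y - c) *\<^sub>R Q y y" if y: "norm y = 1" for y
  proof -
    have yy: "y \<bullet> y = 1" using y by (simp add: norm_eq_1)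
    have "sphere_laplacian (\<lambda>y h. 2 *\<^sub>R Q y h) (\<lambda>y h w. 2 *\<^sub>R Q h w) y
        = 2 *\<^sub>R trace_Q - (2 * ?d) *\<^sub>R Q y y"
      by (simp add: sphere_laplacian_def trace_Q_def scaleR_sum_right algebra_simps)
    moreover have "Q y y \<bullet> trace_Q = ?d + 2 - 2 * gram y y"
      using inner_trace_Q_diag[of y] by (simp add: yy inner_commute)
    ultimately show ?thesis
      by (simp add: tension_field_eq[OF y] P y inner_diff_right inner_Q_diag_diag yy c_def)
        (simp add: algebra_simps)
  qed
  have xx: "x \<bullet> x = 1" using x by (simp add: norm_eq_1)
  have energy: "(\<Sum>b\<in>Basis. 2 *\<^sub>R Q x b \<bullet> 2 *\<^sub>R Q x b) - 2 *\<^sub>R Q x x \<bullet> 2 *\<^sub>R Q x x = 4 * ?g - 4"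
    by (simp add: gram_def sum_distrib_left inner_Q_diag_diag xx)
  \<comment> \<open>The multiple of \<open>Q x x\<close> in the Laplacian of the tension field; the projection annihilates it.\<close>
  define k where "k = 8 * (\<Sum>b\<in>Basis. gram b b) - (8 * ?g + 16 * ?g + 16 * ?g + 2 * (4 * ?g - c))
      - (?d - 1) * (8 * ?g + 2 * (4 * ?g - c))"
  have Qop: "Q x (gram_op x) = (\<Sum>b\<in>Basis. gram x b *\<^sub>R Q x b)"
    by (simp add: gram_op_def bounded_bilinear.sum_right[OF bounded_bilinear_Q] Q_simps)
  have lap: "sphere_laplacian
      (\<lambda>y h. (8 * gram y h) *\<^sub>R Q y y + (2 * (4 * gram y y - c)) *\<^sub>R Q y h)
      (\<lambda>y h w. (8 * gram h w) *\<^sub>R Q y y + (16 * gram y w) *\<^sub>R Q y h + (16 * gram y h) *\<^sub>R Q y w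
        + (2 * (4 * gram y y - c)) *\<^sub>R Q h w) x
      = 32 *\<^sub>R Q x (gram_op x) + (2 * (4 * ?g - c)) *\<^sub>R trace_Q + k *\<^sub>R Q x x"
  proof -
    have "(\<Sum>b\<in>Basis. (8 * gram b b) *\<^sub>R Q x x + (16 * gram x b) *\<^sub>R Q x b + (16 * gram x b) *\<^sub>R Q x b
        + (2 * (4 * ?g - c)) *\<^sub>R Q b b)
        = (8 * (\<Sum>b\<in>Basis. gram b b)) *\<^sub>R Q x x + 32 *\<^sub>R Q x (gram_op x)
        + (2 * (4 * ?g - c)) *\<^sub>R trace_Q"
    proof -
      have "(16 * r) *\<^sub>R v + (16 * r) *\<^sub>R v = 32 *\<^sub>R r *\<^sub>R v" for r and v :: 'b
        by (simp add: scaleR_left_distrib[symmetric])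
      then show ?thesis
        unfolding Qop trace_Q_def
        by (simp add: sum.distrib scaleR_sum_right scaleR_sum_left sum_distrib_left add.assoc)
    qed
    then show ?thesis
      unfolding sphere_laplacian_def k_def
      by (simp only: scaleR_left_diff_distrib scaleR_left_distrib scaleR_right_distrib scaleR_scaleR)
        (simp only: algebra_simps)
  qed
  have op: "Q x x \<bullet> Q x (gram_op x) = ?g"
    by (simp add: inner_Q_diag_polar xx inner_gram_op)
  have tr: "Q x x \<bullet> trace_Q = ?d + 2 - 2 * ?g"
    using inner_trace_Q_diag[of x] by (simp add: xx inner_commute)
  have normal: "Q x x \<bullet> (32 *\<^sub>R Q x (gram_op x) + (2 * (4 * ?g - c)) *\<^sub>R trace_Q + k *\<^sub>R Q x x)
      = 32 * ?g + 2 * (4 * ?g - c) * (?d + 2 - 2 * ?g) + k"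
    by (simp add: inner_add_right op tr inner_Q_diag_diag xx)
  have proj: "tangent_proj (sphere 0 1) (Q x x)
        (32 *\<^sub>R Q x (gram_op x) + (2 * (4 * ?g - c)) *\<^sub>R trace_Q + k *\<^sub>R Q x x)
      = 32 *\<^sub>R Q x (gram_op x) + (2 * (4 * ?g - c)) *\<^sub>R trace_Q
        - (32 * ?g + 2 * (4 * ?g - c) * (?d + 2 - 2 * ?g)) *\<^sub>R Q x x"
    unfolding P[OF x] normal by (simp add: scaleR_add_left)
  have collect: "w + a *\<^sub>R t - p *\<^sub>R q + r *\<^sub>R (2 *\<^sub>R t + s *\<^sub>R q)
      = (a + 2 * r) *\<^sub>R t + (r * s - p) *\<^sub>R q + w" for a p r s and t q w :: 'b
    by (simp add: algebra_simps)
  have "bitension_field (sphere 0 1) (sphere 0 1) \<phi> x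
      = 32 *\<^sub>R Q x (gram_op x) + (2 * (4 * ?g - c)) *\<^sub>R trace_Q
        - (32 * ?g + 2 * (4 * ?g - c) * (?d + 2 - 2 * ?g)) *\<^sub>R Q x x
        + (4 * ?g - 4) *\<^sub>R (2 *\<^sub>R trace_Q + (4 * ?g - c) *\<^sub>R Q x x)"
    using bitension_field_eq[OF x two_derivatives_tension tension]
    by (simp only: lap proj energy)
  also have "\<dots> = (2 * (4 * ?g - c) + 2 * (4 * ?g - 4)) *\<^sub>R trace_Q
      + ((4 * ?g - 4) * (4 * ?g - c) - (32 * ?g + 2 * (4 * ?g - c) * (?d + 2 - 2 * ?g))) *\<^sub>R Q x x
      + 32 *\<^sub>R Q x (gram_op x)"
    by (rule collect)
  \<comment> \<open>It remains to compare coefficients. Only that of \<open>Q x x\<close> needs an identity for \<open>Q\<close>: its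
    constant term \<open>4 * ((?d + 2) * ?d)\<close> is rewritten by means of \<open>inner_trace_Q_self\<close>.\<close>
  also have "2 * (4 * ?g - c) + 2 * (4 * ?g - 4) = - (4 * (?d + 4 - 4 * ?g))"
    by (simp add: c_def)
  also have "(4 * ?g - 4) * (4 * ?g - c) - (32 * ?g + 2 * (4 * ?g - c) * (?d + 2 - 2 * ?g))
      = 4 * ((?d + 2) * ?d) + 16 * (?d + 2) - 8 * (3 * ?d + 12) * ?g + 32 * ?g\<^sup>2"
    by (simp add: c_def algebra_simps power2_eq_square)
  also have "\<dots> = 8 * (\<Sum>b\<in>Basis. gram b b) + 4 * (trace_Q \<bullet> trace_Q)
      - 8 * (3 * ?d + 12) * ?g + 32 * ?g\<^sup>2 + 16 * (?d + 2)"
    unfolding inner_trace_Q_self[symmetric] by simp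
  finally show ?thesis .
qed

end

section \<open>Matrices\<close>

lemma sum_Basis_vec:
  fixes g :: "real^'a::finite \<Rightarrow> 'c::comm_monoid_add"
  shows "(\<Sum>b\<in>Basis. g b) = (\<Sum>i\<in>UNIV. g (axis i (1::real)))"
proof -
  have *: "Basis = (\<lambda>i. axis i (1::real)) ` (UNIV :: 'a set)"
    by (auto simp: Basis_vec_def)
  show ?thesis
    unfolding * by (simp add: sum.reindex inj_on_def axis_eq_axis)
qed

lemma trace_eq_sum_Basis:
  fixes M :: "real^'a^'a::finite"
  shows "trace M = (\<Sum>b\<in>Basis. b \<bullet> (M *v b))"
  by (simp add: sum_Basis_vec trace_def inner_axis' matrix_vector_mul_component inner_axis)

theorem theorem4p1:
  fixes m n :: nat
    and A :: "'b::finite \<Rightarrow> real^'a^'a::finite"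
    and F \<phi> :: "real^'a \<Rightarrow> real^'b"
    and S :: "real^'a^'a"
    and x :: "real^'a"
  assumes dim: "CARD('a) = m + 1" "CARD('b) = n + 1"
    and sym: "\<And>k. transpose (A k) = A k"
    and F: "\<And>y. F y = (\<chi> k. y \<bullet> (A k *v y))"
    and F_sphere: "\<And>y. norm y = 1 \<Longrightarrow> norm (F y) = 1"
    and phi: "\<And>y. y \<in> sphere 0 1 \<Longrightarrow> \<phi> y = F y"
    and nonconst: "\<not> \<phi> constant_on sphere 0 1"
    and S: "S = (\<Sum>k\<in>UNIV. A k ** A k)"
    and x: "x \<in> sphere 0 1"
  shows "bitension_field (sphere 0 1) (sphere 0 1) \<phi> x =
      - (4 * (real m + 5 - 4 * (x \<bullet> (S *v x)))) *\<^sub>R (\<chi> k. trace (A k))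
      + (8 * trace S + 4 * (\<Sum>k\<in>UNIV. (trace (A k))\<^sup>2)
          - 8 * (3 * real m + 15) * (x \<bullet> (S *v x))
          + 32 * (x \<bullet> (S *v x))\<^sup>2 + 16 * (real m + 3)) *\<^sub>R \<phi> x
      + 32 *\<^sub>R (\<chi> k. x \<bullet> (A k *v (S *v x)))"
proof -
  define Q :: "real^'a \<Rightarrow> real^'a \<Rightarrow> real^'b" where "Q = (\<lambda>u v. \<chi> k. u \<bullet> (A k *v v))"
  have adj: "u \<bullet> (A k *v v) = (A k *v u) \<bullet> v" for k u v
    using dot_lmul_matrix[of u "A k" v] sym[of k] by (metis transpose_matrix_vector)
  interpret spherical_quadratic Q
  proof
    show "bilinear Q"
      by (auto simp: bilinear_def linear_iff Q_def vec_eq_iff inner_add_left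
          inner_add_right matrix_vector_right_distrib matrix_vector_mult_scaleR)
    show "Q u v = Q v u" for u v
      unfolding Q_def by (subst adj) (simp add: inner_commute)
    show "norm (Q y y) = 1" if "norm y = 1" for y
      using F_sphere[OF that] by (simp add: F Q_def)
  qed
  have Sv: "S *v v = (\<Sum>k\<in>UNIV. A k *v (A k *v v))" for v
  proof -
    have "(\<Sum>k\<in>I. A k ** A k) *v v = (\<Sum>k\<in>I. (A k ** A k) *v v)" for I :: "'b set"
      by (induction I rule: infinite_finite_induct)
        (simp_all add: matrix_vector_mult_add_rdistrib)
    then show ?thesis by (simp add: S matrix_vector_mul_assoc)
  qed
  have gram: "gram u v = u \<bullet> (S *v v)" for u v
  proof -
    have "gram u v = (\<Sum>b\<in>Basis. \<Sum>k\<in>UNIV. ((A k *v u) \<bullet> b) * ((A k *v v) \<bullet> b))"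
      unfolding gram_def by (simp add: Q_def inner_vec_def[where 'b='b] adj)
    also have "\<dots> = (\<Sum>k\<in>UNIV. (A k *v u) \<bullet> (A k *v v))"
      by (subst sum.swap, intro sum.cong refl, rule euclidean_inner[symmetric])
    also have "\<dots> = u \<bullet> (S *v v)"
      by (simp add: Sv adj inner_sum_right)
    finally show ?thesis .
  qed
  have op: "gram_op x = S *v x"
  proof (rule vector_eq_rdot[THEN iffD1], intro allI)
    fix h
    show "gram_op x \<bullet> h = (S *v x) \<bullet> h"
      using inner_gram_op[of h x] gram_commute[of x h] by (simp add: gram inner_commute)
  qed
  have tr: "trace_Q = (\<chi> k. trace (A k))"
    unfolding trace_Q_def by (simp add: Q_def vec_eq_iff trace_eq_sum_Basis)
  have trS: "(\<Sum>b\<in>Basis. gram b b) = trace S"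
    by (simp add: gram trace_eq_sum_Basis)
  have tr2: "trace_Q \<bullet> trace_Q = (\<Sum>k\<in>UNIV. (trace (A k))\<^sup>2)"
    by (simp add: tr inner_vec_def power2_eq_square)
  have d: "real DIM(real^'a) = real m + 1" using dim by simp
  have coeffs: "real m + 1 + 4 = real m + 5" "3 * (real m + 1) + 12 = 3 * real m + 15"
    "real m + 1 + 2 = real m + 3" by simp_all
  have unit_x: "norm x = 1" using x by simp
  have phiQ: "\<phi> y = Q y y" if "norm y = 1" for y
    using phi[of y] that by (simp add: F Q_def)
  have Qop: "Q x (S *v x) = (\<chi> k. x \<bullet> (A k *v (S *v x)))" by (simp add: Q_def)
  show ?thesis
    using bitension_field_quadratic[OF phiQ unit_x]
    unfolding tr2 trS unfolding tr gram op phiQ[OF unit_x] Qop d coeffs .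
qed

end
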